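(* Let $k\geqslant3$ and $1\leqslant d\leqslant k-1$ with $k-d\geqslant d$. For all $n\geqslant d+2$ and $2\leqslant m\leqslant\min\{n,k-d\}-1$, $$A(n,m)=A(n-1,m-1)+A(n,m+1).$$
   Context: A permutation $\pi\in\mathfrak S_n$ avoids a pattern $\tau\in\mathfrak S_k$ if no subsequence of $\pi$ of length $k$ is order-isomorphic to $\tau$. For $a,b\geqslant1$, $w(a,b)=(a,a-1,\dots,1,a+b,a+b-1,\dots,a+1)$. Let $T^{d,k}=\{(1,2,3),w(k-d,d)\}$. For $n\geqslant1$, $1\leqslant m\leqslant n$ and $i_1,\dots,i_m\in\{1,\dots,n\}$, $g_n(i_1,\dots,i_m)$ is the number of permutations $\pi\in\mathfrak S_n$ avoiding both patterns of $T^{d,k}$ with $\pi_j=i_j$ for $j=1,\dots,m$. For positive integers $n,m$, let $\mathcal I(n,m)$ be the set of integer tuples $(i_1,\dots,i_m)$ with $m-j\leqslant i_{j+1}\leqslant i_j-1$ for $j=0,\dots,m-1$, where $i_0:=n-d+1$ (i.e. $n-d\geqslant i_1>i_2>\dots>i_m\geqslant1$), and set $A(n,m)=\sum_{(i_1,\dots,i_m)\in\mathcal I(n,m)}g_n(i_1,\dots,i_m)$. *)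

theory Defs
  imports Main "HOL-Library.Sublist" "HOL-Combinatorics.Multiset_Permutations"
begin

text \<open>
  Permutations are given in one-line notation, as lists: an element of
  \<open>permutations_of_set {1..n}\<close> is a list containing each of \<open>1, \<dots>, n\<close> exactly once.
  List positions are counted from \<open>0\<close>, so the entry \<open>\<pi>\<^sub>j\<close> is \<open>\<pi> ! (j - 1)\<close>.
\<close>

definition order_isomorphic :: "nat list \<Rightarrow> nat list \<Rightarrow> bool" where
  "order_isomorphic \<sigma> \<tau> \<longleftrightarrow>
     length \<sigma> = length \<tau> \<and>
     (\<forall>i < length \<tau>. \<forall>j < length \<tau>. \<sigma> ! i < \<sigma> ! j \<longleftrightarrow> \<tau> ! i < \<tau> ! j)"

definition avoids :: "nat list \<Rightarrow> nat list \<Rightarrow> bool" where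
  "avoids \<pi> \<tau> \<longleftrightarrow> \<not> (\<exists>\<sigma>. subseq \<sigma> \<pi> \<and> order_isomorphic \<sigma> \<tau>)"

text \<open>\<open>w a b\<close> is \<open>(a, a - 1, \<dots>, 1, a + b, a + b - 1, \<dots>, a + 1)\<close>.\<close>

definition w :: "nat \<Rightarrow> nat \<Rightarrow> nat list" where
  "w a b = rev [1..<a + 1] @ rev [a + 1..<a + b + 1]"

definition T :: "nat \<Rightarrow> nat \<Rightarrow> nat list set" where
  "T d k = {[1, 2, 3], w (k - d) d}"

text \<open>
  Index tuples are integer lists. The number \<open>g d k n [i\<^sub>1, \<dots>, i\<^sub>m]\<close> counts the permutations
  of \<open>{1..n}\<close> that avoid \<open>T d k\<close> and begin with \<open>i\<^sub>1, \<dots>, i\<^sub>m\<close>.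
\<close>

definition g :: "nat \<Rightarrow> nat \<Rightarrow> nat \<Rightarrow> int list \<Rightarrow> nat" where
  "g d k n is =
     card {\<pi> \<in> permutations_of_set {1..n}.
             (\<forall>\<tau> \<in> T d k. avoids \<pi> \<tau>) \<and> map int (take (length is) \<pi>) = is}"

text \<open>
  Prepending \<open>i\<^sub>0 = n - d + 1\<close> to the tuple makes \<open>i\<^sub>j\<close> the entry at position \<open>j\<close>.
  Differences are taken in the integers to avoid truncation.
\<close>

definition index_tuples :: "nat \<Rightarrow> nat \<Rightarrow> nat \<Rightarrow> int list set" where
  "index_tuples d n m =
     {is. length is = m \<and>
          (let i = (\<lambda>j. ((int n - int d + 1) # is) ! j)
           in \<forall>j < m. int m - int j \<le> i (j + 1) \<and> i (j + 1) \<le> i j - 1)}"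

lemma finite_index_tuples: "finite (index_tuples d n m)"
proof (rule finite_subset)
  show "index_tuples d n m \<subseteq> {is. set is \<subseteq> {1..int n} \<and> length is = m}"
  proof
    fix xs assume xs: "xs \<in> index_tuples d n m"
    have step: "int m - int j \<le> xs ! j \<and> xs ! j \<le> ((int n - int d + 1) # xs) ! j - 1"
      if "j < m" for j
      using xs that by (auto simp: index_tuples_def Let_def)
    have "xs ! j \<le> int n" if "j < m" for j
      using that
    proof (induction j)
      case 0
      then show ?case using step[of 0] by simp
    next
      case (Suc j)
      then show ?case using step[of "Suc j"] by simp
    qed
    moreover have "1 \<le> xs ! j" if "j < m" for j
      using step[OF that] that by linarith
    moreover have "length xs = m"
      using xs by (simp add: index_tuples_def)
    ultimately show "xs \<in> {is. set is \<subseteq> {1..int n} \<and> length is = m}"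
      by (auto simp: in_set_conv_nth)
  qed
  show "finite {is. set is \<subseteq> {1..int n} \<and> length is = m}"
    by (rule finite_lists_length_eq) simp
qed

definition A :: "nat \<Rightarrow> nat \<Rightarrow> nat \<Rightarrow> nat \<Rightarrow> nat" where
  "A d k n m = (\<Sum>is \<in> index_tuples d n m. g d k n is)"

end

theory Submission
  imports Defs
begin

text \<open>
  \<open>A d k n m\<close> counts the avoiders of \<open>{1..n}\<close> whose first \<open>m\<close> entries decrease from a value at
  most \<open>n - d\<close>. If the decrease stops after \<open>m\<close> entries, the next entry must be \<open>n\<close>, and for
  \<open>m < k - d\<close> this \<open>n\<close> lies in no occurrence of either pattern, so it can be deleted or inserted
  freely. Hence \<open>A(n,m) - A(n,m+1)\<close> counts the avoiders of \<open>{1..n-1}\<close> with \<open>m\<close> decreasing entries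
  starting at most at \<open>n - d\<close>. Those starting exactly at \<open>n - d\<close> can drop their first entry: only
  \<open>d - 1\<close> entries exceed it, too few for the second block of \<open>w (k - d) d\<close>, and any \<open>123\<close> it starts
  is also started by the smaller entry after it. Deleting the maximum in \<open>A(n-1,m-1)\<close> in the
  same way yields the same two counts.
\<close>

section \<open>Pattern avoidance when a new maximum is inserted\<close>

lemma avoids_subseq:
  assumes "avoids \<pi> \<tau>" and "subseq \<rho> \<pi>"
  shows "avoids \<rho> \<tau>"
  using assms unfolding avoids_def by (meson subseq_order.trans)

lemma subseq_imp_set_subset: "subseq xs ys \<Longrightarrow> set xs \<subseteq> set ys"
  by (induction rule: list_emb.induct) auto

text \<open>An occurrence that is not already in \<open>u @ v\<close> uses \<open>x\<close>. Being
  the maximum, \<open>x\<close> must play a largest letter of \<open>\<tau>\<close>, at index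
  \<open>p\<close>, so the letters of \<open>\<tau>\<close> before \<open>p\<close> are matched by a
  subsequence \<open>s\<close> of \<open>u\<close>. The assumption \<open>new\<close> excludes
  exactly this.\<close>

lemma avoids_insert_max:
  assumes av: "avoids (u @ v) \<tau>"
    and max: "\<And>y. y \<in> set (u @ v) \<Longrightarrow> y < x"
    and new: "\<And>s p. \<lbrakk>subseq s u; order_isomorphic s (take (length s) \<tau>); p = length s;
                p < length \<tau>; \<And>q. q < length \<tau> \<Longrightarrow> \<tau> ! q \<le> \<tau> ! p\<rbrakk> \<Longrightarrow> False"
  shows "avoids (u @ x # v) \<tau>"
  unfolding avoids_def
proof (rule notI, elim exE conjE)
  fix \<sigma> assume sub: "subseq \<sigma> (u @ x # v)" and iso: "order_isomorphic \<sigma> \<tau>"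
  obtain s t where st: "\<sigma> = s @ t" "subseq s u" "subseq t (x # v)"
    using sub by (auto simp: subseq_append_iff)
  show False
  proof (cases "subseq t v")
    case True
    then show False
      using av iso st unfolding avoids_def by (metis list_emb_append_mono)
  next
    case False
    then obtain t' where t: "t = x # t'" "subseq t' v"
      using st(3) by (cases t) (auto split: if_splits)
    let ?p = "length s"
    have len: "length \<sigma> = length \<tau>" using iso by (simp add: order_isomorphic_def)
    have p: "?p < length \<tau>" using len st t by simp
    have set: "set \<sigma> \<subseteq> insert x (set (u @ v))"
      using subseq_imp_set_subset[OF sub] by simp
    have top: "\<tau> ! q \<le> \<tau> ! ?p" if "q < length \<tau>" for q
    proof (rule ccontr)
      assume "\<not> \<tau> ! q \<le> \<tau> ! ?p"
      then have "\<sigma> ! ?p < \<sigma> ! q"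
        using iso that p by (simp add: order_isomorphic_def)
      moreover have "\<sigma> ! ?p = x" using st t by simp
      moreover have "\<sigma> ! q \<le> x"
        using set max nth_mem[of q \<sigma>] that len by fastforce
      ultimately show False by simp
    qed
    have "order_isomorphic s (take ?p \<tau>)"
      unfolding order_isomorphic_def
    proof (intro conjI allI impI)
      show "length s = length (take ?p \<tau>)" using p by simp
      fix i j assume "i < length (take ?p \<tau>)" "j < length (take ?p \<tau>)"
      then have ij: "i < ?p" "j < ?p" "i < length \<tau>" "j < length \<tau>" by auto
      then have "\<sigma> ! i < \<sigma> ! j \<longleftrightarrow> \<tau> ! i < \<tau> ! j"
        using iso by (simp add: order_isomorphic_def)
      then show "s ! i < s ! j \<longleftrightarrow> take ?p \<tau> ! i < take ?p \<tau> ! j"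
        using ij st(1) by (simp add: nth_append)
    qed
    then show False using new[OF st(2) _ refl p top] by blast
  qed
qed

lemma length_w: "length (w a b) = a + b"
  by (simp add: w_def)

lemma nth_w:
  "i < a \<Longrightarrow> w a b ! i = a - i"
  "a \<le> i \<Longrightarrow> i < a + b \<Longrightarrow> w a b ! i = 2 * a + b - i"
  by (auto simp: w_def nth_append rev_nth simp del: upt_Suc)

text \<open>The largest letter \<open>a + b\<close> of \<open>w a b\<close> has index
  \<open>a\<close>, but fewer than \<open>a\<close> entries precede \<open>x\<close>.\<close>

lemma avoids_w_insert_max:
  assumes "avoids (u @ v) (w a b)" and "\<And>y. y \<in> set (u @ v) \<Longrightarrow> y < x"
    and "length u < a" and "1 \<le> b"
  shows "avoids (u @ x # v) (w a b)"
proof (rule avoids_insert_max[OF assms(1,2)])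
  fix s p
  assume "subseq s u" "p = length s" and top: "\<And>q. q < length (w a b) \<Longrightarrow> w a b ! q \<le> w a b ! p"
  then have "p < a"
    using assms(3) list_emb_length by fastforce
  then show False
    using top[of a] assms(4) by (simp add: length_w nth_w)
qed

lemma sorted_wrt_subseq:
  assumes "subseq xs ys" and "sorted_wrt P ys"
  shows "sorted_wrt P xs"
  using assms
proof (induction rule: list_emb.induct)
  case (list_emb_Cons2 x y xs ys)
  then show ?case using list_emb_set by fastforce
qed auto

text \<open>As the letter 3, \<open>x\<close> would need an ascent before it, and \<open>u\<close>
  is decreasing.\<close>

lemma avoids_123_insert_max:
  assumes "avoids (u @ v) [1, 2, 3]" and "\<And>y. y \<in> set (u @ v) \<Longrightarrow> y < x"
    and "sorted_wrt (>) u"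
  shows "avoids (u @ x # v) [1, 2, 3]"
proof (rule avoids_insert_max[OF assms(1,2)])
  fix s p
  assume s: "subseq s u" "order_isomorphic s (take (length s) [1, 2, 3])" "p = length s"
    "p < length [1, 2, 3 :: nat]"
    and top: "\<And>q. q < length [1, 2, 3 :: nat] \<Longrightarrow> [1, 2, 3 :: nat] ! q \<le> [1, 2, 3] ! p"
  have "p = 2" using top[of 2] s(4) by (auto simp: less_Suc_eq nth_Cons')
  then obtain y z where yz: "s = [y, z]" using s(3)
    by (auto simp: numeral_2_eq_2 length_Suc_conv)
  then have "y < z"
    using s(2) by (auto simp: order_isomorphic_def All_less_Suc)
  then show False
    using sorted_wrt_subseq[OF s(1) assms(3)] yz by simp
qed

section \<open>Pattern avoidance under increasing relabelling and under prepending an entry\<close>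

lemma order_isomorphic_map:
  assumes "strict_mono f"
  shows "order_isomorphic (map f \<sigma>) \<tau> \<longleftrightarrow> order_isomorphic \<sigma> \<tau>"
  using assms by (auto simp: order_isomorphic_def strict_mono_less)

lemma avoids_map_iff:
  assumes "strict_mono f"
  shows "avoids (map f \<pi>) \<tau> \<longleftrightarrow> avoids \<pi> \<tau>"
proof
  assume "avoids (map f \<pi>) \<tau>"
  then show "avoids \<pi> \<tau>"
    unfolding avoids_def using order_isomorphic_map[OF assms] subseq_map by blast
next
  assume av: "avoids \<pi> \<tau>"
  show "avoids (map f \<pi>) \<tau>"
    unfolding avoids_def
  proof (rule notI, elim exE conjE)
    fix \<sigma> assume "subseq \<sigma> (map f \<pi>)" "order_isomorphic \<sigma> \<tau>"
    moreover from this(1) obtain \<sigma>' where "\<sigma> = map f \<sigma>'" "subseq \<sigma>' \<pi>"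
      by (auto simp: subseq_conv_nths nths_map)
    ultimately show False
      using av order_isomorphic_map[OF assms] unfolding avoids_def by blast
  qed
qed

lemma avoids_Cons:
  assumes "avoids \<rho> \<tau>"
    and "\<And>\<sigma>. subseq \<sigma> \<rho> \<Longrightarrow> order_isomorphic (h # \<sigma>) \<tau> \<Longrightarrow> False"
  shows "avoids (h # \<rho>) \<tau>"
  unfolding avoids_def
proof (rule notI, elim exE conjE)
  fix \<sigma> assume sub: "subseq \<sigma> (h # \<rho>)" and iso: "order_isomorphic \<sigma> \<tau>"
  show False
  proof (cases "subseq \<sigma> \<rho>")
    case True
    then show False using assms(1) iso unfolding avoids_def by blast
  next
    case False
    then obtain \<sigma>' where "\<sigma> = h # \<sigma>'" "subseq \<sigma>' \<rho>"
      using sub by (cases \<sigma>) (auto split: if_splits)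
    then show False using assms(2) iso by blast
  qed
qed

lemma avoids_123_Cons:
  assumes "avoids \<rho> [1, 2, 3]" and "\<rho> \<noteq> []" and "hd \<rho> < h"
  shows "avoids (h # \<rho>) [1, 2, 3]"
proof (rule avoids_Cons[OF assms(1)])
  fix \<sigma> assume sub: "subseq \<sigma> \<rho>" and iso: "order_isomorphic (h # \<sigma>) [1, 2, 3]"
  from iso obtain y z where yz: "\<sigma> = [y, z]"
    by (auto simp: order_isomorphic_def length_Suc_conv)
  have "h < y" "y < z"
    using iso yz by (auto simp: order_isomorphic_def All_less_Suc)
  obtain r \<rho>' where r: "\<rho> = r # \<rho>'" using assms(2) by (cases \<rho>) auto
  \<comment> \<open>Since \<open>r < h < y\<close>, the entry \<open>y\<close> is not
    \<open>r\<close>, so both \<open>y\<close> and \<open>z\<close> come after \<open>r\<close>,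
    which can then replace \<open>h\<close>.\<close>
  then have "subseq [y, z] \<rho>'"
    using sub yz \<open>h < y\<close> assms(3) by (auto split: if_splits)
  then have "subseq [r, y, z] \<rho>" using r by simp
  moreover have "order_isomorphic [r, y, z] [1, 2, 3]"
    using r assms(3) \<open>h < y\<close> \<open>y < z\<close> by (auto simp: order_isomorphic_def All_less_Suc)
  ultimately show False using assms(1) unfolding avoids_def by blast
qed

text \<open>In a new occurrence \<open>h\<close> plays the first letter \<open>a\<close>, so the
  second block needs \<open>b\<close> distinct entries above \<open>h\<close>.\<close>

lemma avoids_w_Cons:
  assumes "avoids \<rho> (w a b)" and "1 \<le> a" and "distinct \<rho>" and "card {y \<in> set \<rho>. h < y} < b"
  shows "avoids (h # \<rho>) (w a b)"
proof (rule avoids_Cons[OF assms(1)])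
  fix \<sigma> assume sub: "subseq \<sigma> \<rho>" and iso: "order_isomorphic (h # \<sigma>) (w a b)"
  have len: "length (h # \<sigma>) = a + b" using iso by (simp add: order_isomorphic_def length_w)
  \<comment> \<open>\<open>?B\<close> matches the second block, which starts at index
    \<open>a\<close> of \<open>h # \<sigma>\<close>, that is, at index \<open>a - 1\<close> of
    \<open>\<sigma>\<close>.\<close>
  let ?B = "drop (a - 1) \<sigma>"
  have "h < y" if y: "y \<in> set ?B" for y
  proof -
    obtain i where i: "i < length ?B" "y = ?B ! i" using y by (metis in_set_conv_nth)
    then have "(h # \<sigma>) ! (a + i) = y" "a + i < a + b"
      using len assms(2) by (auto simp: nth_Cons')
    moreover have "w a b ! 0 < w a b ! (a + i)"
      using \<open>a + i < a + b\<close> assms(2) by (simp add: nth_w)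
    moreover have "(h # \<sigma>) ! 0 < (h # \<sigma>) ! (a + i) \<longleftrightarrow> w a b ! 0 < w a b ! (a + i)"
      using iso \<open>a + i < a + b\<close> unfolding order_isomorphic_def length_w by (metis not_gr_zero not_less_zero)
    ultimately show ?thesis by simp
  qed
  moreover have "set ?B \<subseteq> set \<rho>"
    using subseq_imp_set_subset[OF sub] set_drop_subset[of "a - 1" \<sigma>] by blast
  ultimately have "card (set ?B) \<le> card {y \<in> set \<rho>. h < y}"
    by (intro card_mono) auto
  moreover have "distinct ?B"
    using assms(3) sub by (auto simp: subseq_conv_nths)
  then have "card (set ?B) = b"
    using len assms(2) by (simp add: distinct_card)
  ultimately show False using assms(4) by simp
qed

section \<open>Index tuples as decreasing beginnings of avoiders\<close>

definition avoiders :: "nat \<Rightarrow> nat \<Rightarrow> nat \<Rightarrow> nat list set" where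
  "avoiders d k n = {\<pi> \<in> permutations_of_set {1..n}. \<forall>\<tau> \<in> T d k. avoids \<pi> \<tau>}"

text \<open>The bound \<open>c\<close> is a separate parameter because deleting the maximum lowers
  \<open>n\<close> but leaves the bound on the first entry unchanged.\<close>

definition dec_start :: "nat \<Rightarrow> nat \<Rightarrow> nat \<Rightarrow> nat \<Rightarrow> nat \<Rightarrow> nat list set" where
  "dec_start d k n m c = {\<pi> \<in> avoiders d k n. sorted_wrt (>) (take m \<pi>) \<and> hd \<pi> \<le> c}"

lemma mem_avoiders:
  "\<pi> \<in> avoiders d k n \<longleftrightarrow>
     set \<pi> = {1..n} \<and> distinct \<pi> \<and> avoids \<pi> [1, 2, 3] \<and> avoids \<pi> (w (k - d) d)"
  by (auto simp: avoiders_def T_def permutations_of_set_def)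

lemma length_avoiders: "\<pi> \<in> avoiders d k n \<Longrightarrow> length \<pi> = n"
  by (metis mem_avoiders card_atLeastAtMost diff_Suc_1 distinct_card)

lemma finite_avoiders: "finite (avoiders d k n)"
  by (simp add: avoiders_def)

lemma finite_dec_start: "finite (dec_start d k n m c)"
  using finite_avoiders by (auto simp: dec_start_def)

lemma decreasing_nth_ge:
  assumes "sorted_wrt (>) xs" and "\<And>x. x \<in> set xs \<Longrightarrow> 1 \<le> (x :: int)" and "j < length xs"
  shows "int (length xs) - int j \<le> xs ! j"
  using assms
proof (induction xs arbitrary: j)
  case (Cons x xs)
  show ?case
  proof (cases j)
    case 0
    show ?thesis
    proof (cases "xs = []")
      case False
      then have "int (length xs) \<le> xs ! 0" "xs ! 0 < x"
        using Cons.IH[of 0] Cons.prems by auto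
      then show ?thesis using 0 by simp
    qed (use Cons.prems 0 in auto)
  next
    case (Suc i)
    then show ?thesis using Cons.IH[of i] Cons.prems by simp
  qed
qed simp

text \<open>For positive entries the lower bounds in \<open>index_tuples\<close> follow from strict
  decrease, by \<open>decreasing_nth_ge\<close>. The upper bounds express the decrease and, at
  \<open>j = 0\<close>, the bound on the head.\<close>

lemma index_tuples_iff:
  assumes "is \<noteq> []" and "length is = m" and "\<And>x. x \<in> set is \<Longrightarrow> 1 \<le> x"
  shows "is \<in> index_tuples d n m \<longleftrightarrow> sorted_wrt (>) is \<and> hd is \<le> int n - int d"
proof
  assume "is \<in> index_tuples d n m"
  then have step: "is ! j \<le> ((int n - int d + 1) # is) ! j - 1" if "j < m" for j
    using that by (auto simp: index_tuples_def Let_def)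
  have "is ! Suc i < is ! i" if "Suc i < length is" for i
    using step[of "Suc i"] that assms(2) by simp
  then have "sorted_wrt (>) is"
    by (subst sorted_wrt_iff_nth_Suc_transp) (auto intro: transpI)
  then show "sorted_wrt (>) is \<and> hd is \<le> int n - int d"
    using step[of 0] assms(1,2) by (auto simp: hd_conv_nth)
next
  assume *: "sorted_wrt (>) is \<and> hd is \<le> int n - int d"
  have "is ! j \<le> ((int n - int d + 1) # is) ! j - 1" if "j < m" for j
    using * that assms(1,2)
    by (cases j) (auto simp: hd_conv_nth intro: sorted_wrt_nth_less[of "(>)" "is"])
  moreover have "int m - int j \<le> is ! j" if "j < m" for j
    using decreasing_nth_ge[of "is" j] * that assms(2,3) by simp
  ultimately show "is \<in> index_tuples d n m"
    using assms(2) by (simp add: index_tuples_def Let_def)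
qed

text \<open>The sum counts disjoint classes of avoiders, sorted by their first \<open>m\<close>
  entries. With \<open>d \<le> n\<close> the natural number \<open>n - d\<close> agrees with the
  integer difference.\<close>

lemma A_eq_card_dec_start:
  assumes "1 \<le> m" and "m \<le> n" and "d \<le> n"
  shows "A d k n m = card (dec_start d k n m (n - d))"
proof -
  let ?F = "\<lambda>is. {\<pi> \<in> avoiders d k n. map int (take m \<pi>) = is}"
  have "A d k n m = (\<Sum>is \<in> index_tuples d n m. card (?F is))"
    unfolding A_def
    by (intro sum.cong refl) (auto simp: g_def avoiders_def index_tuples_def intro!: arg_cong[of _ _ card])
  also have "\<dots> = card (\<Union>is \<in> index_tuples d n m. ?F is)"
    by (rule card_UN_disjoint[symmetric]) (auto simp: finite_index_tuples finite_avoiders)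
  also have "(\<Union>is \<in> index_tuples d n m. ?F is) = dec_start d k n m (n - d)"
  proof -
    have "map int (take m \<pi>) \<in> index_tuples d n m \<longleftrightarrow> sorted_wrt (>) (take m \<pi>) \<and> hd \<pi> \<le> n - d"
      if "\<pi> \<in> avoiders d k n" for \<pi>
    proof -
      have len: "length \<pi> = n" using that by (rule length_avoiders)
      have "set \<pi> = {1..n}" using that by (simp add: mem_avoiders)
      then have "1 \<le> x" if "x \<in> set (map int (take m \<pi>))" for x
        using that by (auto dest: in_set_takeD)
      moreover have "\<pi> \<noteq> []" using len assms by auto
      ultimately show ?thesis
        using index_tuples_iff[of "map int (take m \<pi>)" m d n] len assms
        by (auto simp: sorted_wrt_map hd_map)
    qed
    then show ?thesis by (auto simp: dec_start_def)
  qed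
  finally show ?thesis .
qed

section \<open>Inserting and deleting the maximum after a decreasing beginning\<close>

lemma insert_max_mem_dec_start:
  assumes "1 \<le> m" and "m \<le> n" and "m < k - d" and "1 \<le> d"
    and \<rho>: "\<rho> \<in> dec_start d k n m c"
  shows "take m \<rho> @ Suc n # drop m \<rho> \<in> dec_start d k (Suc n) m c"
proof -
  have mem: "\<rho> \<in> avoiders d k n" and dec: "sorted_wrt (>) (take m \<rho>)" and hd: "hd \<rho> \<le> c"
    using \<rho> by (auto simp: dec_start_def)
  have len: "length \<rho> = n" using mem by (rule length_avoiders)
  have split: "take m \<rho> @ drop m \<rho> = \<rho>" by simp
  have less: "y < Suc n" if "y \<in> set (take m \<rho> @ drop m \<rho>)" for y
    using mem that unfolding split by (auto simp: mem_avoiders)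
  have "avoids (take m \<rho> @ Suc n # drop m \<rho>) [1, 2, 3]"
    by (rule avoids_123_insert_max) (use mem dec less in \<open>auto simp: mem_avoiders\<close>)
  moreover have "avoids (take m \<rho> @ Suc n # drop m \<rho>) (w (k - d) d)"
    by (rule avoids_w_insert_max) (use mem less assms len in \<open>auto simp: mem_avoiders\<close>)
  \<comment> \<open>Being a rearrangement of \<open>Suc n # \<rho>\<close>, the new list has the
    same entries and is distinct.\<close>
  moreover have "mset (take m \<rho> @ Suc n # drop m \<rho>) = mset (Suc n # \<rho>)"
    using arg_cong[OF split, of mset] unfolding mset_append by simp
  note mset_eq_setD[OF this] mset_eq_imp_distinct_iff[OF this]
  moreover have "set (Suc n # \<rho>) = {1..Suc n}" "distinct (Suc n # \<rho>)"
    using mem by (auto simp: mem_avoiders)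
  moreover have "hd (take m \<rho> @ Suc n # drop m \<rho>) = hd \<rho>"
    using assms len by (cases \<rho>) (auto simp: hd_append)
  ultimately show ?thesis
    using dec hd assms(2) len by (simp add: dec_start_def mem_avoiders)
qed

lemma delete_max_mem_dec_start:
  assumes "1 \<le> m" and "\<pi> \<in> dec_start d k (Suc n) m c" and "m \<le> n" and "\<pi> ! m = Suc n"
  defines "\<rho> \<equiv> take m \<pi> @ drop (Suc m) \<pi>"
  shows "\<rho> \<in> dec_start d k n m c" and "\<pi> = take m \<rho> @ Suc n # drop m \<rho>"
proof -
  have mem: "\<pi> \<in> avoiders d k (Suc n)" using assms(2) by (simp add: dec_start_def)
  have len: "length \<pi> = Suc n" using mem by (rule length_avoiders)
  have \<pi>: "\<pi> = take m \<pi> @ Suc n # drop (Suc m) \<pi>"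
    using id_take_nth_drop[of m \<pi>] len assms by simp
  have take: "take m \<rho> = take m \<pi>" and drop: "drop m \<rho> = drop (Suc m) \<pi>"
    using len assms(3) by (auto simp: \<rho>_def)
  show "\<pi> = take m \<rho> @ Suc n # drop m \<rho>"
    using \<pi> take drop by simp
  have "subseq \<rho> \<pi>"
    \<comment> \<open>The third \<open>\<pi>\<close> is the whole list on the right; only this one
      is split at its maximum.\<close>
    unfolding \<rho>_def by (subst (3) \<pi>) (intro list_emb_append_mono subseq_order.refl list_emb_Cons)
  then have "avoids \<rho> [1, 2, 3]" "avoids \<rho> (w (k - d) d)"
    using mem avoids_subseq by (auto simp: mem_avoiders)
  moreover have mset: "mset \<pi> = mset (Suc n # \<rho>)"
    by (subst \<pi>) (simp add: \<rho>_def)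
  have "distinct (Suc n # \<rho>)" "set (Suc n # \<rho>) = {1..Suc n}"
    using mem mset_eq_setD[OF mset] mset_eq_imp_distinct_iff[OF mset] by (auto simp: mem_avoiders)
  then have "distinct \<rho>" "set \<rho> = {1..Suc n} - {Suc n}" by auto
  moreover have "{1..Suc n} - {Suc n} = {1..n}" by auto
  moreover have "hd \<rho> = hd \<pi>"
    using assms(1) len by (cases \<pi>; cases m) (auto simp: \<rho>_def)
  ultimately show "\<rho> \<in> dec_start d k n m c"
    using assms(2) take by (simp add: dec_start_def mem_avoiders)
qed

text \<open>The first ascent \<open>\<pi>\<^sub>m < \<pi>\<^sub>m\<^sub>+\<^sub>1\<close> must go up to the maximum, since a larger entry to its right
  would complete a \<open>123\<close>.\<close>

lemma first_ascent_max:
  assumes "\<pi> \<in> dec_start d k n m c" and "1 \<le> m" and "m < n" and "c < n"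
    and "\<not> sorted_wrt (>) (take (Suc m) \<pi>)"
  shows "\<pi> ! m = n"
proof (rule ccontr)
  assume neq: "\<pi> ! m \<noteq> n"
  have mem: "\<pi> \<in> avoiders d k n" and dec: "sorted_wrt (>) (take m \<pi>)" and hd: "hd \<pi> \<le> c"
    using assms(1) by (auto simp: dec_start_def)
  have len: "length \<pi> = n" using mem by (rule length_avoiders)
  have set: "set \<pi> = {1..n}" and dist: "distinct \<pi>" using mem by (auto simp: mem_avoiders)
  \<comment> \<open>The first \<open>m\<close> entries do decrease, so the failure comes from some
    entry before index \<open>m\<close> that is not above \<open>\<pi> ! m\<close>.\<close>
  obtain i where i: "i < m" "\<pi> ! i \<le> \<pi> ! m"
    using assms(3,5) dec len
    by (auto simp: take_Suc_conv_app_nth sorted_wrt_append in_set_conv_nth not_less)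
  then have "\<pi> ! i < \<pi> ! m"
    using dist len assms(3) nth_eq_iff_index_eq[of \<pi> i m] by simp
  obtain j where j: "j < n" "\<pi> ! j = n"
  proof -
    have "n \<in> set \<pi>" using set assms(3) by simp
    then show thesis using that len by (auto simp: in_set_conv_nth)
  qed
  have "\<pi> ! m < n"
    using neq set len assms(3) nth_mem[of m \<pi>] by auto
  \<comment> \<open>The largest of the first \<open>m\<close> entries is \<open>\<pi> ! 0\<close>,
    at most \<open>c < n\<close>, so \<open>n\<close> is not among them.\<close>
  have "m < j"
  proof (rule ccontr)
    assume "\<not> m < j"
    then have "j < m" using j neq by (cases "j = m") auto
    then have "\<pi> ! j \<le> \<pi> ! 0"
      using sorted_wrt_nth_less[OF dec, of 0 j] len assms(3) by (cases "j = 0") auto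
    moreover have "\<pi> ! 0 \<le> c" using hd len assms(3) by (cases \<pi>) auto
    ultimately show False using j assms(4) by simp
  qed
  have "subseq [\<pi> ! i, \<pi> ! m, \<pi> ! j] \<pi>"
  proof -
    have "\<pi> = take i \<pi> @ \<pi> ! i # drop (Suc i) \<pi>"
      using id_take_nth_drop[of i \<pi>] i len assms(3) by simp
    moreover have "subseq [\<pi> ! m, \<pi> ! j] (drop (Suc i) \<pi>)"
    proof -
      have "drop m \<pi> = \<pi> ! m # drop (Suc m) \<pi>"
        using len assms(3) by (simp add: Cons_nth_drop_Suc)
      moreover have "\<pi> ! j \<in> set (drop (Suc m) \<pi>)"
        using \<open>m < j\<close> j len by (auto simp: in_set_conv_nth intro!: exI[of _ "j - Suc m"])
      ultimately have "subseq [\<pi> ! m, \<pi> ! j] (drop m \<pi>)"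
        by (simp add: subseq_singleton_left)
      moreover have "drop m \<pi> = drop (m - Suc i) (drop (Suc i) \<pi>)" using i by simp
      ultimately show ?thesis
        using subseq_order.trans[OF _ subseq_drop_many[OF subseq_order.refl]]
        by (metis append_take_drop_id)
    qed
    ultimately show ?thesis
      by (metis subseq_Cons2 subseq_drop_many)
  qed
  moreover have "order_isomorphic [\<pi> ! i, \<pi> ! m, \<pi> ! j] [1, 2, 3]"
    using \<open>\<pi> ! i < \<pi> ! m\<close> \<open>\<pi> ! m < n\<close> j by (auto simp: order_isomorphic_def All_less_Suc)
  ultimately show False
    using mem unfolding mem_avoiders avoids_def by blast
qed

text \<open>The entry at index \<open>m\<close> either continues the decrease or is the maximum
  \<open>Suc n\<close>. In the second case, deleting it is inverse to \<open>?f\<close>.\<close>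

lemma card_dec_start_split:
  assumes "1 \<le> m" and "m \<le> n" and "c \<le> n" and "m < k - d" and "1 \<le> d"
  shows "card (dec_start d k (Suc n) m c) =
           card (dec_start d k (Suc n) (Suc m) c) + card (dec_start d k n m c)"
proof -
  let ?f = "\<lambda>\<rho>. take m \<rho> @ Suc n # drop m \<rho>"
  let ?S = "dec_start d k (Suc n) (Suc m) c" and ?D = "dec_start d k n m c"
  have nth: "?f \<rho> ! m = Suc n" if "\<rho> \<in> ?D" for \<rho>
  proof -
    have "length \<rho> = n" using that length_avoiders by (auto simp: dec_start_def)
    then show ?thesis using assms(2) by (simp add: nth_append)
  qed
  have inj: "inj_on ?f ?D"
  proof (rule inj_onI)
    fix x y assume "x \<in> ?D" "y \<in> ?D" "?f x = ?f y"
    moreover from this have "length x = n" "length y = n"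
      using length_avoiders by (auto simp: dec_start_def)
    ultimately show "x = y"
      by (metis append_eq_append_conv append_take_drop_id length_take list.inject)
  qed
  \<comment> \<open>In \<open>?S\<close> the entry at index \<open>m\<close> lies below the first
    entry, hence below \<open>Suc n\<close>.\<close>
  have disj: "?S \<inter> ?f ` ?D = {}"
  proof -
    have False if \<pi>: "\<pi> \<in> ?S" "\<pi> ! m = Suc n" for \<pi>
    proof -
      have len: "length \<pi> = Suc n" using \<pi> length_avoiders by (auto simp: dec_start_def)
      have "sorted_wrt (>) (take (Suc m) \<pi>)" using \<pi> by (simp add: dec_start_def)
      from sorted_wrt_nth_less[OF this, of 0 m] have "\<pi> ! m < \<pi> ! 0"
        using len assms by simp
      moreover have "\<pi> ! 0 \<le> c"
        using \<pi> len by (cases \<pi>) (auto simp: dec_start_def)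
      ultimately show False using \<pi> assms(3) by simp
    qed
    then show ?thesis using nth by blast
  qed
  have "dec_start d k (Suc n) m c = ?S \<union> ?f ` ?D"
  proof (intro equalityI subsetI)
    fix \<pi> assume \<pi>: "\<pi> \<in> dec_start d k (Suc n) m c"
    show "\<pi> \<in> ?S \<union> ?f ` ?D"
    proof (cases "sorted_wrt (>) (take (Suc m) \<pi>)")
      case True
      then show ?thesis using \<pi> by (simp add: dec_start_def)
    next
      case False
      then have "\<pi> ! m = Suc n" using first_ascent_max[OF \<pi>] assms by simp
      then show ?thesis
        using delete_max_mem_dec_start[OF assms(1) \<pi> assms(2)] by blast
    qed
  next
    fix \<pi> assume "\<pi> \<in> ?S \<union> ?f ` ?D"
    then show "\<pi> \<in> dec_start d k (Suc n) m c"
    proof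
      assume \<pi>: "\<pi> \<in> ?S"
      then have "length \<pi> = Suc n" using length_avoiders by (auto simp: dec_start_def)
      then show ?thesis
        using \<pi> assms(2) by (auto simp: dec_start_def take_Suc_conv_app_nth sorted_wrt_append)
    next
      assume "\<pi> \<in> ?f ` ?D"
      then show ?thesis using insert_max_mem_dec_start assms by blast
    qed
  qed
  then show ?thesis
    using card_Un_disjoint[OF finite_dec_start _ disj] card_image[OF inj] finite_dec_start
    by simp
qed

section \<open>Removing the first entry and closing the gap in the values\<close>

text \<open>The increasing enumeration of the naturals other than \<open>h\<close>; it frees the
  value \<open>h\<close> for a new first entry.\<close>

definition shift_above :: "nat \<Rightarrow> nat \<Rightarrow> nat" where
  "shift_above h x = (if x < h then x else Suc x)"

lemma strict_mono_shift_above: "strict_mono (shift_above h)"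
  by (auto simp: strict_mono_def shift_above_def)

lemma shift_above_image:
  assumes "1 \<le> h" and "h \<le> Suc n"
  shows "shift_above h ` {1..n} = {1..Suc n} - {h}"
proof (intro equalityI subsetI)
  fix y assume "y \<in> {1..Suc n} - {h}"
  then show "y \<in> shift_above h ` {1..n}"
    using assms
    by (intro image_eqI[of _ _ "if y < h then y else y - 1"]) (auto simp: shift_above_def)
qed (use assms in \<open>auto simp: shift_above_def split: if_splits\<close>)

text \<open>Only \<open>d - 1\<close> values exceed the head \<open>Suc n - d + 1\<close>, so
  putting it in front creates no \<open>w (k - d) d\<close>; the smaller entry after it excludes a
  new 123. Dropping it and closing the gap is the inverse.\<close>

lemma card_dec_start_hd:
  assumes "1 \<le> m" and "m \<le> n" and "1 \<le> d" and "d \<le> n" and "d < k" and "Suc n - d + 1 \<le> c"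
  shows "card {\<pi> \<in> dec_start d k (Suc n) (Suc m) c. hd \<pi> = Suc n - d + 1} =
    card (dec_start d k n m (Suc n - d))"
proof -
  let ?h = "Suc n - d + 1"
  let ?s = "shift_above ?h"
  let ?f = "\<lambda>\<rho>. ?h # map ?s \<rho>"
  let ?D = "dec_start d k n m (Suc n - d)"
  have h: "1 \<le> ?h" "?h \<le> Suc n" using assms by auto
  note mono = strict_mono_shift_above[of ?h]
  have inj_s: "inj ?s" using mono by (rule strict_mono_imp_inj_on)
  have low: "?s x = x" if "x < ?h" for x using that by (simp add: shift_above_def)
  have "{\<pi> \<in> dec_start d k (Suc n) (Suc m) c. hd \<pi> = ?h} = ?f ` ?D"
  proof (intro equalityI subsetI)
    fix \<pi> assume "\<pi> \<in> {\<pi> \<in> dec_start d k (Suc n) (Suc m) c. hd \<pi> = ?h}"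
    then have mem: "\<pi> \<in> avoiders d k (Suc n)" and dec: "sorted_wrt (>) (take (Suc m) \<pi>)"
      and hd: "hd \<pi> = ?h"
      by (auto simp: dec_start_def)
    have len: "length \<pi> = Suc n" using mem by (rule length_avoiders)
    obtain t where \<pi>: "\<pi> = ?h # t" using hd len by (cases \<pi>) auto
    have t: "set t = {1..Suc n} - {?h}" "distinct t"
      using mem \<pi> by (auto simp: mem_avoiders)
    \<comment> \<open>Since \<open>t\<close> avoids the value \<open>?h\<close>, it is the shift of
      some list \<open>\<rho>\<close> over \<open>{1..n}\<close>.\<close>
    then have "t \<in> lists (?s ` {1..n})" using shift_above_image[OF h] by auto
    then obtain \<rho> where \<rho>: "t = map ?s \<rho>" "set \<rho> \<subseteq> {1..n}"
      by (auto simp: lists_image)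
    have "?s ` set \<rho> = ?s ` {1..n}" using t \<rho> shift_above_image[OF h] by simp
    then have "set \<rho> = {1..n}" using inj_s by (simp add: inj_image_eq_iff)
    moreover have "distinct \<rho>" using t \<rho> by (simp add: distinct_map)
    moreover have "avoids t \<tau>" if "avoids \<pi> \<tau>" for \<tau>
      using that \<pi> by (rule_tac avoids_subseq) auto
    then have "avoids \<rho> [1, 2, 3]" "avoids \<rho> (w (k - d) d)"
      using mem \<rho>(1) avoids_map_iff[OF mono] by (auto simp: mem_avoiders)
    moreover have "sorted_wrt (>) (take m \<rho>)"
      using dec \<pi> \<rho>(1) mono by (simp add: take_map sorted_wrt_map strict_mono_less)
    \<comment> \<open>As \<open>m \<ge> 1\<close>, the second entry of \<open>\<pi>\<close> belongs
      to the decreasing beginning, so it lies below \<open>?h\<close>, where the shift is the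
      identity.\<close>
    moreover have "hd \<rho> \<le> Suc n - d"
    proof -
      obtain r \<rho>' where r: "\<rho> = r # \<rho>'" using len \<pi> \<rho>(1) assms by (cases \<rho>) auto
      then have "?s r < ?h" using dec \<pi> \<rho>(1) assms by (cases m) auto
      then show ?thesis using r by (auto simp: shift_above_def split: if_splits)
    qed
    ultimately have "\<rho> \<in> ?D" by (simp add: dec_start_def mem_avoiders)
    then show "\<pi> \<in> ?f ` ?D" using \<pi> \<rho>(1) by blast
  next
    fix \<pi> assume "\<pi> \<in> ?f ` ?D"
    then obtain \<rho> where \<pi>: "\<pi> = ?f \<rho>" and mem: "\<rho> \<in> avoiders d k n"
      and dec: "sorted_wrt (>) (take m \<rho>)" and hd: "hd \<rho> \<le> Suc n - d"
      by (auto simp: dec_start_def)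
    have len: "length \<rho> = n" using mem by (rule length_avoiders)
    obtain r \<rho>' where r: "\<rho> = r # \<rho>'" using len assms by (cases \<rho>) auto
    have set: "set (map ?s \<rho>) = {1..Suc n} - {?h}"
      using mem shift_above_image[OF h] by (simp add: mem_avoiders)
    have dist: "distinct (map ?s \<rho>)"
      using mem inj_s by (auto simp: mem_avoiders distinct_map intro: inj_on_subset)
    have av: "avoids (map ?s \<rho>) [1, 2, 3]" "avoids (map ?s \<rho>) (w (k - d) d)"
      using mem avoids_map_iff[OF mono] by (auto simp: mem_avoiders)
    have "avoids \<pi> [1, 2, 3]"
      unfolding \<pi> by (rule avoids_123_Cons[OF av(1)]) (use r hd low in auto)
    moreover have "avoids \<pi> (w (k - d) d)"
      unfolding \<pi>
    proof (rule avoids_w_Cons[OF av(2) _ dist])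
      have "{y \<in> set (map ?s \<rho>). ?h < y} = {?h<..Suc n}" unfolding set by auto
      then show "card {y \<in> set (map ?s \<rho>). ?h < y} < d" using assms by simp
    qed (use assms in simp)
    moreover have "sorted_wrt (>) (take (Suc m) \<pi>)"
    proof -
      \<comment> \<open>All of the decreasing beginning is bounded by its head
        \<open>r < ?h\<close>, so the shift leaves it unchanged and \<open>?h\<close> extends the
        decrease.\<close>
      have "y \<le> r" if "y \<in> set (take m \<rho>)" for y
        using that dec r assms(1) by (cases m) auto
      then have "y < ?h" if "y \<in> set (take m \<rho>)" for y using that hd r by fastforce
      then have "map ?s (take m \<rho>) = take m \<rho>" "\<forall>y \<in> set (take m \<rho>). y < ?h"
        using low by (auto intro: map_idI)
      then show ?thesis using dec \<pi> by (simp add: take_map)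
    qed
    ultimately show "\<pi> \<in> {\<pi> \<in> dec_start d k (Suc n) (Suc m) c. hd \<pi> = ?h}"
      using set dist h assms(6) \<pi> by (auto simp: dec_start_def mem_avoiders)
  qed
  moreover have "inj_on ?f ?D"
    using inj_s by (auto simp: inj_on_def)
  ultimately show ?thesis by (simp add: card_image)
qed

section \<open>Combining the two bijections into the recurrence\<close>

theorem theorem2p3:
  fixes k d n m :: nat
  assumes "3 \<le> k" and "1 \<le> d" and "d \<le> k - 1" and "d \<le> k - d"
    and "d + 2 \<le> n"
    and "2 \<le> m" and "m \<le> min n (k - d) - 1"
  shows "A d k n m = A d k (n - 1) (m - 1) + A d k n (m + 1)"
proof -
  obtain n' where n: "n = Suc (Suc n')" using assms by (cases n; cases "n - 1") auto
  obtain m' where m: "m = Suc m'" using assms by (cases m) auto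
  let ?D = "\<lambda>N M c. card (dec_start d k N M c)"
  have le: "1 \<le> m'" "m' \<le> n'" "d \<le> n'" "m < k - d" "d < k" using assms n m by auto
  \<comment> \<open>Here \<open>n - d = Suc n' - d + 1\<close>, so a head at most
    \<open>n - d\<close> either equals this value or is at most \<open>Suc n' - d\<close>, the bound
    that belongs to \<open>A d k (n - 1)\<close>.\<close>
  have "{\<pi> \<in> dec_start d k (Suc n') m (n - d). hd \<pi> = Suc n' - d + 1} \<union>
      dec_start d k (Suc n') m (Suc n' - d) = dec_start d k (Suc n') m (n - d)"
    using n le by (auto simp: dec_start_def)
  then have "?D (Suc n') m (n - d) =
      card {\<pi> \<in> dec_start d k (Suc n') m (n - d). hd \<pi> = Suc n' - d + 1} + ?D (Suc n') m (Suc n' - d)"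
    by (subst card_Un_disjoint[symmetric])
       (auto simp: finite_dec_start, simp add: dec_start_def)
  also have "\<dots> = ?D n' m' (Suc n' - d) + ?D (Suc n') m (Suc n' - d)"
    unfolding m using card_dec_start_hd[of m' n' d k "n - d"] le assms(2) n by simp
  \<comment> \<open>The split at \<open>m'\<close> is read from right to left: the two terms are the
    beginnings where the maximum follows and those where the decrease goes on.\<close>
  also have "\<dots> = ?D (Suc n') m' (Suc n' - d)"
    using card_dec_start_split[of m' n' "Suc n' - d" k d] le assms(2) m by simp
  also have "\<dots> = A d k (n - 1) (m - 1)"
    using A_eq_card_dec_start[of m' "Suc n'" d k] le n m by simp
  finally have "?D (Suc n') m (n - d) = A d k (n - 1) (m - 1)" .
  \<comment> \<open>The same split, now at \<open>m\<close> and for permutations of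
    \<open>{1..n}\<close>.\<close>
  moreover have "A d k n m = ?D n (m + 1) (n - d) + ?D (Suc n') m (n - d)"
    using A_eq_card_dec_start[of m n d k] card_dec_start_split[of m "Suc n'" "n - d" k d]
      le assms(2) n m by simp
  moreover have "A d k n (m + 1) = ?D n (m + 1) (n - d)"
    using A_eq_card_dec_start[of "m + 1" n d k] le n m by simp
  ultimately show ?thesis by simp
qed

end
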